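(* Let $\mu\in(0,\infty)^d$ and let $Y=(Y_1,\dots,Y_d)$ have independent entries with $Y_i$ Poisson distributed with expectation $\mu_i$. Let $\hat\mu:\mathbb{Z}^d\to(0,\infty)^d$ be any mapping, and define $$\mathrm{PUKLA}=\|\hat\mu(Y)\|_1-\langle Y,\log\hat\mu_\downarrow(Y)\rangle,\qquad \hat\mu_\downarrow(Y)_i=\hat\mu_i(Y-e_i).$$ Then $\mathrm{PUKLA}$ is an unbiased estimator of $\mathrm{MKLA}+\|\mu\|_1-\langle\mu,\log\mu\rangle$, i.e. (the quantities involved being assumed integrable) $$\mathbb{E}[\mathrm{PUKLA}]=\mathrm{MKLA}+\|\mu\|_1-\langle\mu,\log\mu\rangle,$$ where $\mathrm{MKLA}=\mathbb{E}\big[D(P_\mu\,\|\,P_{\hat\mu(Y)})\big]$ is given by $$\mathrm{MKLA}=\mathbb{E}\big[\|\hat\mu(Y)\|_1-\langle\mu,\log\hat\mu(Y)-\log\mu\rangle\big]-\|\mu\|_1 .$$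
   Context: $e_i$ is the $i$-th canonical basis vector of $\mathbb{R}^d$; $\log$ acts entry-wise on vectors; $\|\cdot\|_1$ is the $\ell^1$ norm. $P_m$ ($m\in(0,\infty)^d$) denotes the law of a vector with independent Poisson entries of means $m_1,\dots,m_d$, and $D(P_0\|P_1)=\int\log\frac{dP_0}{dP_1}\,dP_0$ is the Kullback-Leibler divergence; in $D(P_\mu\|P_{\hat\mu(Y)})$ it is evaluated at the random parameter $\hat\mu(Y)$. Expectations are with respect to $Y\sim P_\mu$. *)

theory Defs
  imports "HOL-Probability.Probability"
begin

definition l1_norm :: "real ^ 'd \<Rightarrow> real" where
  "l1_norm x = (\<Sum>i\<in>UNIV. \<bar>x $ i\<bar>)"

definition ln_vec :: "real ^ 'd \<Rightarrow> real ^ 'd" where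
  "ln_vec x = (\<chi> i. ln (x $ i))"

definition real_vec :: "int ^ 'd \<Rightarrow> real ^ 'd" where
  "real_vec y = (\<chi> i. real_of_int (y $ i))"

text \<open>
  The Poisson distribution is transported along the inclusion of the natural numbers into
  the integers, so that sample points can be shifted by unit vectors without truncation.
\<close>

definition poisson_int :: "real \<Rightarrow> int pmf" where
  "poisson_int m = map_pmf int (poisson_pmf m)"

text \<open>
  The law \<open>P\<^sub>m\<close> of a vector with independent Poisson entries of means \<open>m\<^sub>1, \<dots>, m\<^sub>d\<close>.
  The default value \<open>0\<close> of \<^const>\<open>Pi_pmf\<close> plays no role, since the index set is
  the whole type. Only meaningful for entrywise positive \<open>m\<close>.
\<close>

definition poisson_vec :: "real ^ 'd \<Rightarrow> (int ^ 'd) pmf" where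
  "poisson_vec m = map_pmf vec_lambda (Pi_pmf UNIV 0 (\<lambda>i. poisson_int (m $ i)))"

text \<open>
  \<open>KL_div P\<^sub>0 P\<^sub>1 = \<integral> log (dP\<^sub>0/dP\<^sub>1) dP\<^sub>0\<close> with the natural logarithm. The library's
  \<^const>\<open>KL_divergence\<close> takes the reference measure \<open>P\<^sub>1\<close> first.
\<close>

definition KL_div :: "'a measure \<Rightarrow> 'a measure \<Rightarrow> real" where
  "KL_div P0 P1 = KL_divergence (exp 1) P1 P0"

definition poisson_KL :: "real ^ 'd \<Rightarrow> real ^ 'd \<Rightarrow> real" where
  "poisson_KL m m' = KL_div (measure_pmf (poisson_vec m)) (measure_pmf (poisson_vec m'))"

definition MKLA ::
  "'a measure \<Rightarrow> ('a \<Rightarrow> int ^ 'd) \<Rightarrow> real ^ 'd \<Rightarrow> (int ^ 'd \<Rightarrow> real ^ 'd) \<Rightarrow> real" where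
  "MKLA M Y \<mu> \<mu>hat = (\<integral>\<omega>. poisson_KL \<mu> (\<mu>hat (Y \<omega>)) \<partial>M)"

definition shift_down :: "(int ^ 'd \<Rightarrow> real ^ 'd) \<Rightarrow> int ^ 'd \<Rightarrow> real ^ 'd" where
  "shift_down f y = (\<chi> i. f (y - axis i 1) $ i)"

definition PUKLA :: "(int ^ 'd \<Rightarrow> real ^ 'd) \<Rightarrow> int ^ 'd \<Rightarrow> real" where
  "PUKLA \<mu>hat y = l1_norm (\<mu>hat y) - real_vec y \<bullet> ln_vec (shift_down \<mu>hat y)"

end

(*
  The Poisson weights satisfy k p(k) = \<mu> p(k - 1), so reindexing a sum over the integer lattice gives
  the Stein identity E[Y_i f(Y - e_i)] = \<mu>_i E[f(Y)].  Applied to f = 1 it evaluates the divergence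
  D(P_\<mu> || P_m) = \<Sum>_i m_i - \<mu>_i - \<mu>_i log (m_i / \<mu>_i); applied to f = log of the i-th
  entry of the estimator it trades \<mu>_i log for the observable term of PUKLA.
  The expectation may be split term by term because the summands of the divergence are nonnegative
  and m_i is at most twice the i-th summand plus a constant, so integrability of the divergence
  gives that of each entry of the estimator and of its logarithm.
*)

theory Submission
  imports Defs
begin

subsection \<open>Poisson weights on the integer lattice\<close>

lemma pmf_poisson_int:
  assumes "0 < m"
  shows "pmf (poisson_int m) k = (if k < 0 then 0 else m ^ nat k / fact (nat k) * exp (- m))"
proof (cases "k < 0")
  case True
  then have "k \<notin> int ` UNIV" by auto
  then show ?thesis
    using True by (auto simp: poisson_int_def pmf_eq_0_set_pmf)
next
  case False
  then obtain n where "k = int n" by (metis int_eq_iff not_less)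
  then show ?thesis
    using assms by (simp add: poisson_int_def pmf_map_inj' inj_on_def)
qed

text \<open>For \<open>k\<close> positive this is \<open>k / k! = 1 / (k - 1)!\<close>. At
  \<open>k = 0\<close> the factor \<open>k\<close> annihilates the left side and the weight at
  \<open>-1\<close> is zero on the right; below that both weights are zero.\<close>

lemma pmf_poisson_int_shift:
  assumes "0 < m"
  shows "real_of_int k * pmf (poisson_int m) k = m * pmf (poisson_int m) (k - 1)"
proof (cases "k \<le> 0")
  case True
  then show ?thesis by (cases "k = 0") (auto simp: pmf_poisson_int assms)
next
  case False
  then obtain n where "k = int (Suc n)" by (metis gr0_implies_Suc not_le zero_less_imp_eq_int)
  then show ?thesis by (simp add: pmf_poisson_int assms field_simps del: of_nat_Suc)
     (simp add: field_simps nat_add_distrib)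
qed

lemma pmf_poisson_vec:
  fixes m :: "real ^ 'd"
  shows "pmf (poisson_vec m) y = (\<Prod>i\<in>UNIV. pmf (poisson_int (m $ i)) (y $ i))"
proof -
  have "inj (vec_lambda :: ('d \<Rightarrow> int) \<Rightarrow> _)" by (simp add: inj_def vec_lambda_inject)
  from pmf_map_inj'[OF this, of _ "\<lambda>i. y $ i"] show ?thesis
    by (simp add: poisson_vec_def pmf_Pi)
qed

lemma pmf_poisson_vec_shift:
  assumes "0 < m $ i"
  shows "real_of_int (y $ i) * pmf (poisson_vec m) y = m $ i * pmf (poisson_vec m) (y - axis i 1)"
proof -
  have "(\<Prod>j\<in>UNIV - {i}. pmf (poisson_int (m $ j)) ((y - axis i 1) $ j))
      = (\<Prod>j\<in>UNIV - {i}. pmf (poisson_int (m $ j)) (y $ j))"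
    by (intro prod.cong) (auto simp: axis_def)
  then show ?thesis
    using pmf_poisson_int_shift[OF assms, of "y $ i"]
    by (simp add: pmf_poisson_vec prod.remove[of UNIV i] axis_def mult.assoc [symmetric])
qed

subsection \<open>The Stein identity\<close>

text \<open>Counting measure, unlike the Poisson law, is invariant under lattice shifts, so the
  weights are moved into the integrand before reindexing.\<close>

lemma
  fixes p :: "'a pmf" and f :: "'a \<Rightarrow> real"
  shows integrable_measure_pmf_iff:
      "integrable (measure_pmf p) f \<longleftrightarrow> integrable (count_space UNIV) (\<lambda>x. pmf p x * f x)"
    and integral_measure_pmf_count_space:
      "measure_pmf.expectation p f = (\<integral>x. pmf p x * f x \<partial>count_space UNIV)"
  unfolding measure_pmf_eq_density
  by (subst integrable_density integral_density; simp)+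

lemma
  fixes m :: "real ^ 'd" and f :: "int ^ 'd \<Rightarrow> real"
  assumes "0 < m $ i" and f: "integrable (poisson_vec m) f"
  shows integrable_poisson_vec_shift:
      "integrable (poisson_vec m) (\<lambda>y. real_of_int (y $ i) * f (y - axis i 1))"
    and expectation_poisson_vec_shift:
      "measure_pmf.expectation (poisson_vec m) (\<lambda>y. real_of_int (y $ i) * f (y - axis i 1))
        = m $ i * measure_pmf.expectation (poisson_vec m) f"
proof -
  let ?g = "\<lambda>y. m $ i * (pmf (poisson_vec m) y * f y)"
  have eq: "(\<lambda>y. pmf (poisson_vec m) y * (real_of_int (y $ i) * f (y - axis i 1)))
      = (\<lambda>y. ?g (y - axis i 1))"
    using pmf_poisson_vec_shift[OF assms(1)] by (auto simp: fun_eq_iff mult_ac)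
  \<comment> \<open>On the full integer lattice the shift is onto, so reindexing produces no
    boundary term.\<close>
  have bij: "bij_betw (\<lambda>y. y - axis i 1) (UNIV :: (int ^ 'd) set) UNIV"
    by (rule bij_betw_byWitness[where f' = "\<lambda>y. y + axis i 1"]) auto
  have "integrable (count_space UNIV) ?g"
    using f by (simp add: integrable_measure_pmf_iff)
  then show "integrable (poisson_vec m) (\<lambda>y. real_of_int (y $ i) * f (y - axis i 1))"
    unfolding integrable_measure_pmf_iff eq by (subst integrable_bij_count_space[OF bij])
  show "measure_pmf.expectation (poisson_vec m) (\<lambda>y. real_of_int (y $ i) * f (y - axis i 1))
        = m $ i * measure_pmf.expectation (poisson_vec m) f"
    unfolding integral_measure_pmf_count_space eq
    by (subst integral_bij_count_space[OF bij]) simp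
qed

lemma
  fixes m :: "real ^ 'd"
  assumes "0 < m $ i"
  shows integrable_poisson_vec_nth: "integrable (poisson_vec m) (\<lambda>y. real_of_int (y $ i))"
    and expectation_poisson_vec_nth:
      "measure_pmf.expectation (poisson_vec m) (\<lambda>y. real_of_int (y $ i)) = m $ i"
  using integrable_poisson_vec_shift[OF assms, of "\<lambda>_. 1"]
    expectation_poisson_vec_shift[OF assms, of "\<lambda>_. 1"] by auto

subsection \<open>The divergence between Poisson laws\<close>

text \<open>Both laws are densities with respect to counting measure, which is sigma-finite on a
  countable type; the inclusion of supports is absolute continuity.\<close>

lemma KL_div_measure_pmf:
  fixes p q :: "'a :: countable pmf"
  assumes "set_pmf p \<subseteq> set_pmf q"
  shows "KL_div (measure_pmf p) (measure_pmf q)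
    = measure_pmf.expectation p (\<lambda>x. ln (pmf p x / pmf q x))"
proof -
  interpret sigma_finite_measure "count_space (UNIV :: 'a set)"
    by (rule sigma_finite_measure_count_space)
  have "KL_div (measure_pmf p) (measure_pmf q)
      = (\<integral>x. pmf p x * log (exp 1) (pmf p x / pmf q x) \<partial>count_space UNIV)"
    unfolding KL_div_def measure_pmf_eq_density using assms
    by (intro KL_density_density) (auto simp: AE_count_space pmf_eq_0_set_pmf)
  then show ?thesis by (simp add: integral_measure_pmf_count_space log_def)
qed

text \<open>The support is the same for all positive means, so any two of these laws are mutually
  absolutely continuous.\<close>

lemma set_pmf_poisson_vec:
  assumes "\<And>i. 0 < m $ i"
  shows "set_pmf (poisson_vec m) = {y. \<forall>i. 0 \<le> y $ i}"
proof -
  have "pmf (poisson_int (m $ i)) k = 0 \<longleftrightarrow> k < 0" for i k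
    using assms[of i] by (simp add: pmf_poisson_int)
  then show ?thesis by (auto simp: set_pmf_iff pmf_poisson_vec not_less)
qed

lemma ln_pmf_poisson_int_ratio:
  assumes "0 < m" "0 < m'" "0 \<le> k"
  shows "ln (pmf (poisson_int m) k / pmf (poisson_int m') k)
    = real_of_int k * ln (m / m') - m + m'"
proof -
  have "pmf (poisson_int m) k / pmf (poisson_int m') k = (m / m') ^ nat k * exp (m' - m)"
    using assms by (simp add: pmf_poisson_int power_divide exp_diff exp_minus field_simps)
  then show ?thesis using assms by (simp add: ln_mult ln_realpow)
qed

text \<open>The factorials cancel in the likelihood ratio, so its logarithm is affine in the counts
  and only their means enter the expectation.\<close>

lemma poisson_KL_eq:
  fixes m m' :: "real ^ 'd"
  assumes m: "\<And>i. 0 < m $ i" and m': "\<And>i. 0 < m' $ i"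
  shows "poisson_KL m m' = (\<Sum>i\<in>UNIV. m' $ i - m $ i - m $ i * ln (m' $ i / m $ i))"
proof -
  have "poisson_KL m m'
      = measure_pmf.expectation (poisson_vec m) (\<lambda>y. ln (pmf (poisson_vec m) y / pmf (poisson_vec m') y))"
    unfolding poisson_KL_def by (rule KL_div_measure_pmf) (simp add: set_pmf_poisson_vec m m')
  also have "\<dots> = measure_pmf.expectation (poisson_vec m)
      (\<lambda>y. \<Sum>i\<in>UNIV. real_of_int (y $ i) * ln (m $ i / m' $ i) - m $ i + m' $ i)"
  \<comment> \<open>Off the support the quotient of weights is \<open>0 / 0\<close>, so the
    integrands are compared only almost everywhere.\<close>
  proof (intro integral_cong_AE)
    have "ln (pmf (poisson_vec m) y / pmf (poisson_vec m') y)
        = (\<Sum>i\<in>UNIV. real_of_int (y $ i) * ln (m $ i / m' $ i) - m $ i + m' $ i)"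
      if "\<And>i. 0 \<le> y $ i" for y
    proof -
      have "pmf (poisson_int (m $ i)) (y $ i) / pmf (poisson_int (m' $ i)) (y $ i) \<noteq> 0" for i
        using m[of i] m'[of i] that[of i] by (simp add: pmf_poisson_int)
      then have "ln (pmf (poisson_vec m) y / pmf (poisson_vec m') y)
          = (\<Sum>i\<in>UNIV. ln (pmf (poisson_int (m $ i)) (y $ i) / pmf (poisson_int (m' $ i)) (y $ i)))"
        unfolding pmf_poisson_vec prod_dividef [symmetric] by (intro ln_prod finite)
      then show ?thesis using m m' that by (simp add: ln_pmf_poisson_int_ratio)
    qed
    then show "AE y in poisson_vec m. ln (pmf (poisson_vec m) y / pmf (poisson_vec m') y)
        = (\<Sum>i\<in>UNIV. real_of_int (y $ i) * ln (m $ i / m' $ i) - m $ i + m' $ i)"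
      by (simp add: AE_measure_pmf_iff set_pmf_poisson_vec m)
  qed simp_all
  also have "\<dots> = (\<Sum>i\<in>UNIV. m $ i * ln (m $ i / m' $ i) - m $ i + m' $ i)"
    by (subst Bochner_Integration.integral_sum)
       (simp_all add: integrable_poisson_vec_nth expectation_poisson_vec_nth m)
  also have "\<dots> = (\<Sum>i\<in>UNIV. m' $ i - m $ i - m $ i * ln (m' $ i / m $ i))"
    by (intro sum.cong) (simp_all add: ln_div m m' algebra_simps)
  finally show ?thesis .
qed

text \<open>Both bounds come from \<open>ln x \<le> x - 1\<close>. At \<open>x = t / m\<close> it
  gives nonnegativity but uses up the whole linear term \<open>t\<close>; at
  \<open>x = t / (2 * m)\<close> only half of \<open>t\<close> is spent, and the rest dominates the
  mean.\<close>

lemma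
  fixes m t :: real
  assumes "0 < m" "0 < t"
  shows poisson_divergence_nonneg: "0 \<le> t - m - m * ln (t / m)"
    and le_poisson_divergence: "t \<le> 2 * (t - m - m * ln (t / m)) + 2 * m"
proof -
  have "m * ln (t / m) \<le> m * (t / m - 1)"
    using assms by (intro mult_left_mono ln_le_minus_one) auto
  then show "0 \<le> t - m - m * ln (t / m)"
    using assms by (simp add: algebra_simps)
  have "ln (t / m) = ln (t / (2 * m)) + ln 2"
    using assms by (simp add: ln_div ln_mult)
  \<comment> \<open>The same inequality bounds \<open>ln 2\<close> by \<open>2 - 1\<close>, which
    cancels the other constant.\<close>
  also have "\<dots> \<le> (t / (2 * m) - 1) + (2 - 1)"
    using assms by (intro add_mono ln_le_minus_one) auto
  finally have "m * ln (t / m) \<le> m * (t / (2 * m))"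
    using assms by (intro mult_left_mono) auto
  then show "t \<le> 2 * (t - m - m * ln (t / m)) + 2 * m"
    using assms by (simp add: field_simps)
qed

subsection \<open>Unbiasedness\<close>

text \<open>The lattice is countable, so the law is determined by its point masses, and independence
  factors these. This moves all expectations from \<open>M\<close> to a pmf.\<close>

lemma distr_indep_poisson_eq_poisson_vec:
  fixes Y :: "'a \<Rightarrow> int ^ 'd"
  assumes "prob_space M"
    and indep: "prob_space.indep_vars M (\<lambda>_. count_space UNIV) (\<lambda>i \<omega>. Y \<omega> $ i) UNIV"
    and distr: "\<And>i. distr M (count_space UNIV) (\<lambda>\<omega>. Y \<omega> $ i) = measure_pmf (poisson_int (\<mu> $ i))"
  shows "Y \<in> measurable M (count_space UNIV)"
    and "distr M (count_space UNIV) Y = measure_pmf (poisson_vec \<mu>)"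
proof -
  interpret prob_space M by fact
  have meas [measurable]: "(\<lambda>\<omega>. Y \<omega> $ i) \<in> measurable M (count_space UNIV)" for i
    using indep by (simp add: indep_vars_def)
  have vimage: "Y -` {y} \<inter> space M = (\<Inter>i\<in>UNIV. (\<lambda>\<omega>. Y \<omega> $ i) -` {y $ i} \<inter> space M)" for y
    by (auto simp: vec_eq_iff)
  show Y [measurable]: "Y \<in> measurable M (count_space UNIV)"
    unfolding measurable_count_space_eq2_countable vimage
    by (intro conjI ballI sets.finite_INT measurable_sets[OF meas]) auto
  have marginal: "prob ((\<lambda>\<omega>. Y \<omega> $ i) -` {k} \<inter> space M) = pmf (poisson_int (\<mu> $ i)) k" for i k
    using arg_cong[OF distr[of i], of "\<lambda>N. measure N {k}"]
    by (simp add: measure_distr[OF meas] measure_pmf_single)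
  have "prob (Y -` {y} \<inter> space M) = pmf (poisson_vec \<mu>) y" for y
    unfolding vimage by (subst indep_varsD[OF indep]) (auto simp: marginal pmf_poisson_vec)
  then show "distr M (count_space UNIV) Y = measure_pmf (poisson_vec \<mu>)"
    by (intro measure_eqI_countable[of _ UNIV])
       (auto simp: emeasure_distr emeasure_eq_measure emeasure_pmf_single)
qed

theorem theorem4p2:
  fixes M :: "'a measure"
    and Y :: "'a \<Rightarrow> int ^ 'd"
    and \<mu> :: "real ^ 'd"
    and \<mu>hat :: "int ^ 'd \<Rightarrow> real ^ 'd"
  assumes "prob_space M"
    and "\<And>i. \<mu> $ i > 0"
    and "prob_space.indep_vars M (\<lambda>_. count_space UNIV) (\<lambda>i \<omega>. Y \<omega> $ i) UNIV"
    and "\<And>i. distr M (count_space UNIV) (\<lambda>\<omega>. Y \<omega> $ i) = measure_pmf (poisson_int (\<mu> $ i))"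
    and "\<And>y i. \<mu>hat y $ i > 0"
    and "integrable M (\<lambda>\<omega>. PUKLA \<mu>hat (Y \<omega>))"
    and "integrable M (\<lambda>\<omega>. poisson_KL \<mu> (\<mu>hat (Y \<omega>)))"
  shows "(\<integral>\<omega>. PUKLA \<mu>hat (Y \<omega>) \<partial>M) = MKLA M Y \<mu> \<mu>hat + l1_norm \<mu> - \<mu> \<bullet> ln_vec \<mu>
    \<and> MKLA M Y \<mu> \<mu>hat
      = (\<integral>\<omega>. l1_norm (\<mu>hat (Y \<omega>)) - \<mu> \<bullet> (ln_vec (\<mu>hat (Y \<omega>)) - ln_vec \<mu>) \<partial>M) - l1_norm \<mu>"
proof -
  note pos = assms(2,5)
  note Y = distr_indep_poisson_eq_poisson_vec[OF assms(1,3,4)]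
  let ?P = "poisson_vec \<mu>"
  let ?E = "measure_pmf.expectation ?P"
  have transport: "(\<integral>\<omega>. f (Y \<omega>) \<partial>M) = ?E f" for f :: "int ^ 'd \<Rightarrow> real"
    using integral_distr[OF Y(1), of f] by (simp add: Y(2))
  \<comment> \<open>\<open>h i y\<close> is the divergence between the \<open>i\<close>-th
    marginals, with means \<open>\<mu> $ i\<close> and \<open>\<mu>hat y $ i\<close>.\<close>
  define h where "h i y = \<mu>hat y $ i - \<mu> $ i - \<mu> $ i * ln (\<mu>hat y $ i / \<mu> $ i)" for i y
  have KL: "poisson_KL \<mu> (\<mu>hat y) = (\<Sum>i\<in>UNIV. h i y)" for y
    by (simp add: h_def poisson_KL_eq pos)
  have h_nonneg: "0 \<le> h i y" for i y
    unfolding h_def using pos by (intro poisson_divergence_nonneg)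
  have "integrable ?P (\<lambda>y. \<Sum>i\<in>UNIV. h i y)"
    using assms(7) integrable_distr_eq[OF Y(1), of "\<lambda>y. \<Sum>i\<in>UNIV. h i y"]
    by (simp add: KL Y(2))
  then have h: "integrable ?P (h i)" for i
    by (rule Bochner_Integration.integrable_bound)
       (auto simp: h_nonneg sum_nonneg intro!: member_le_sum)
  have t: "integrable ?P (\<lambda>y. \<mu>hat y $ i)" for i
  proof (rule Bochner_Integration.integrable_bound)
    show "integrable ?P (\<lambda>y. 2 * h i y + 2 * \<mu> $ i)"
      using h by simp
    have "norm (\<mu>hat y $ i) \<le> norm (2 * h i y + 2 * \<mu> $ i)" for y
      using le_poisson_divergence[OF pos(1)[of i] pos(2)[of y i]] pos(2)[of y i]
      unfolding h_def real_norm_def by linarith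
    then show "AE y in ?P. norm (\<mu>hat y $ i) \<le> norm (2 * h i y + 2 * \<mu> $ i)"
      by simp
  qed simp
  \<comment> \<open>Solving the definition of \<open>h\<close> for the logarithm shows it to be an
    affine combination of integrable functions.\<close>
  have ln_eq: "ln (\<mu>hat y $ i) = (\<mu>hat y $ i - h i y) / \<mu> $ i - 1 + ln (\<mu> $ i)" for i y
    using pos(1)[of i] pos(2)[of y i] by (simp add: h_def ln_div field_simps)
  have ln: "integrable ?P (\<lambda>y. ln (\<mu>hat y $ i))" for i
    unfolding ln_eq using h t by simp
  \<comment> \<open>All three integrals of the claim reduce to \<open>L\<close>, \<open>C\<close>
    and \<open>l1_norm \<mu>\<close>; the conclusion is then arithmetic.\<close>
  define C where "C = (\<Sum>i\<in>UNIV. \<mu> $ i * ln (\<mu> $ i))"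
  define L where "L = (\<Sum>i\<in>UNIV. ?E (\<lambda>y. \<mu>hat y $ i) - \<mu> $ i * ?E (\<lambda>y. ln (\<mu>hat y $ i)))"
  have \<mu>_ln: "\<mu> \<bullet> ln_vec \<mu> = C"
    by (simp add: C_def inner_vec_def ln_vec_def)
  have l1_\<mu>: "l1_norm \<mu> = (\<Sum>i\<in>UNIV. \<mu> $ i)"
    by (simp add: l1_norm_def less_imp_le pos)
  have "PUKLA \<mu>hat = (\<lambda>y.
      \<Sum>i\<in>UNIV. \<mu>hat y $ i - real_of_int (y $ i) * ln (\<mu>hat (y - axis i 1) $ i))"
    by (simp add: fun_eq_iff PUKLA_def l1_norm_def real_vec_def ln_vec_def shift_down_def inner_vec_def
        sum_subtractf less_imp_le pos)
  \<comment> \<open>The Stein identity is applied in each coordinate \<open>i\<close> to the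
    logarithm of the \<open>i\<close>-th entry of \<open>\<mu>hat\<close>, which removes the
    shift.\<close>
  then have PUKLA: "(\<integral>\<omega>. PUKLA \<mu>hat (Y \<omega>) \<partial>M) = L"
    unfolding transport L_def
    using t integrable_poisson_vec_shift[OF pos(1) ln]
      expectation_poisson_vec_shift[OF pos(1) ln]
    by simp
  have "poisson_KL \<mu> (\<mu>hat y)
      = (\<Sum>i\<in>UNIV. \<mu>hat y $ i - \<mu> $ i * ln (\<mu>hat y $ i)) + C - l1_norm \<mu>" for y
    unfolding KL h_def C_def l1_\<mu> sum.distrib [symmetric] sum_subtractf [symmetric]
    by (intro sum.cong) (simp_all add: ln_divide_pos pos algebra_simps)
  then have MKLA: "MKLA M Y \<mu> \<mu>hat = L + C - l1_norm \<mu>"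
    unfolding MKLA_def transport[of "\<lambda>y. poisson_KL \<mu> (\<mu>hat y)"] L_def using t ln by simp
  have "l1_norm (\<mu>hat y) - \<mu> \<bullet> (ln_vec (\<mu>hat y) - ln_vec \<mu>)
      = (\<Sum>i\<in>UNIV. \<mu>hat y $ i - \<mu> $ i * ln (\<mu>hat y $ i)) + C" for y
    by (simp add: inner_diff_right \<mu>_ln)
       (simp add: l1_norm_def ln_vec_def inner_vec_def sum_subtractf less_imp_le pos)
  then have "(\<integral>\<omega>. l1_norm (\<mu>hat (Y \<omega>)) - \<mu> \<bullet> (ln_vec (\<mu>hat (Y \<omega>)) - ln_vec \<mu>) \<partial>M) = L + C"
    unfolding transport[of "\<lambda>y. l1_norm (\<mu>hat y) - \<mu> \<bullet> (ln_vec (\<mu>hat y) - ln_vec \<mu>)"] L_def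
    using t ln by simp
  with PUKLA MKLA \<mu>_ln show ?thesis by simp
qed

end
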